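(* For a Tychonoff space $X$, the following assertions are equivalent: (i) $X$ is an open-compact attainable space; (ii) the natural inclusion map $I:\bigoplus\mathcal{K}(X)\to X$ is a $\kappa$-pseudo open map; (iii) $X$ is the image of some locally compact space under a $\kappa$-pseudo open map.
   Context: All topological spaces are assumed to be Tychonoff. $\mathcal{K}(X)$ is the family of all compact subsets of $X$, $\bigoplus\mathcal{K}(X)=\bigoplus_{K\in\mathcal{K}(X)}K$ is the topological sum (disjoint union) of all of them, and $I$ is the map whose restriction to each summand $K$ is the inclusion $K\hookrightarrow X$. A space $X$ is open-compact attainable if for every open $W\subseteq X$ and every $z\in\overline{W}$ there is a compact $K\subseteq X$ such that $z\in K\cap\overline{K\cap W}$. A continuous surjective map $f:X\to Y$ is called $\kappa$-pseudo open if whenever $y\in Y$, $U$ is open in $X$ and $f^{-1}(y)\subseteq U$, then $y\in\operatorname{Int}\big(\overline{f(U)}\big)$. *)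

theory Defs
  imports "HOL-Analysis.Analysis"
begin

definition tychonoff_space :: "'a topology \<Rightarrow> bool" where
  "tychonoff_space X \<longleftrightarrow> completely_regular_space X \<and> Hausdorff_space X"

definition open_compact_attainable :: "'a topology \<Rightarrow> bool" where
  "open_compact_attainable X \<longleftrightarrow>
     (\<forall>W z. openin X W \<and> z \<in> X closure_of W \<longrightarrow>
        (\<exists>K. compactin X K \<and> z \<in> K \<inter> X closure_of (K \<inter> W)))"

definition kappa_pseudo_open_map :: "'a topology \<Rightarrow> 'b topology \<Rightarrow> ('a \<Rightarrow> 'b) \<Rightarrow> bool" where
  "kappa_pseudo_open_map X Y f \<longleftrightarrow>
     continuous_map X Y f \<and> f ` topspace X = topspace Y \<and>
     (\<forall>y U. y \<in> topspace Y \<and> openin X U \<and> {x \<in> topspace X. f x = y} \<subseteq> U \<longrightarrow>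
        y \<in> Y interior_of (Y closure_of (f ` U)))"

(* The points of the sum are the pairs (K, x) with K compact and x in K,
   so the natural inclusion map I is snd. *)
definition compact_sum :: "'a topology \<Rightarrow> ('a set \<times> 'a) topology" where
  "compact_sum X = sum_topology (\<lambda>K. subtopology X K) {K. compactin X K}"

(* HOL cannot quantify existentially over types, so the type carrying the
   locally compact domain is an explicit parameter. *)
definition kappa_pseudo_open_image_of_locally_compact :: "'b itself \<Rightarrow> 'a topology \<Rightarrow> bool" where
  "kappa_pseudo_open_image_of_locally_compact (_ :: 'b itself) X \<longleftrightarrow>
     (\<exists>(Z :: 'b topology) f.
        tychonoff_space Z \<and> locally_compact_space Z \<and> kappa_pseudo_open_map Z X f)"

end

(* From (iii) to (i): if z is a limit of the open set W but attained by no compact set, each point x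
   of the fibre over z has a neighbourhood inside a compact set, so its image lies in a compact set
   through z; shrinking it makes the image miss W.  The union U of these neighbourhoods contains the
   fibre, so the closure of f(U) is a neighbourhood of z that misses W, a contradiction.
   From (i) to (ii): if y is not interior to the closure of I(U), then y is a limit of the open
   complement W of that closure.  A compact K attaining y along W gives the point (K, y) of the fibre
   over y, and the K-th layer of U is a relative neighbourhood of y in K, so it meets W. *)

theory Submission
  imports Defs
begin

text \<open>Component injections are open. Points of different summands are therefore separated by
  the whole summands, and points of one summand by the images of sets that separate them
  there.\<close>

lemma Hausdorff_space_sum_topology:
  assumes "\<And>i. i \<in> I \<Longrightarrow> Hausdorff_space (X i)"
  shows "Hausdorff_space (sum_topology X I)"
  unfolding Hausdorff_space_def
proof (intro allI impI)
  fix p q assume pq: "p \<in> topspace (sum_topology X I) \<and> q \<in> topspace (sum_topology X I) \<and> p \<noteq> q"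
  obtain i x j y where p: "p = (i, x)" "i \<in> I" "x \<in> topspace (X i)"
    and q: "q = (j, y)" "j \<in> I" "y \<in> topspace (X j)" and ne: "i \<noteq> j \<or> x \<noteq> y"
    using pq by (cases p; cases q) auto
  have layer: "openin (sum_topology X I) (Pair k ` U)" if "k \<in> I" "openin (X k) U" for k U
    using open_map_component_injection[OF that(1), of X] that(2) by (simp add: open_map_def)
  show "\<exists>U V. openin (sum_topology X I) U \<and> openin (sum_topology X I) V \<and>
          p \<in> U \<and> q \<in> V \<and> disjnt U V"
  proof (cases "i = j")
    case True
    then obtain U V where "openin (X i) U" "openin (X i) V" "x \<in> U" "y \<in> V" "disjnt U V"
      using assms[OF \<open>i \<in> I\<close>] p q ne unfolding Hausdorff_space_def by blast
    then show ?thesis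
      using layer[of i U] layer[of i V] p q True
      by (intro exI[of _ "Pair i ` U"] exI[of _ "Pair i ` V"]) (auto simp: disjnt_iff)
  next
    case False
    then show ?thesis
      using layer[of i "topspace (X i)"] layer[of j "topspace (X j)"] p q
      by (intro exI[of _ "Pair i ` topspace (X i)"] exI[of _ "Pair j ` topspace (X j)"])
         (auto simp: disjnt_iff)
  qed
qed

lemma topspace_compact_sum: "topspace (compact_sum X) = {(K, x). compactin X K \<and> x \<in> K}"
  by (auto simp: compact_sum_def dest: subsetD[OF compactin_subset_topspace])

lemma openin_compact_sum_layer:
  assumes "openin (compact_sum X) U" "compactin X K"
  obtains V where "openin X V" "{x. (K, x) \<in> U} = V \<inter> K"
  using assms by (auto simp: compact_sum_def openin_sum_topology openin_subtopology)

lemma locally_compact_space_compact_sum: "locally_compact_space (compact_sum X)"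
  by (simp add: compact_sum_def locally_compact_space_sum_topology
      compact_imp_locally_compact_space compact_space_subtopology)

text \<open>This makes the sum an admissible domain in (iii): complete regularity comes from local
  compactness together with the Hausdorff property.\<close>

lemma tychonoff_space_compact_sum:
  assumes "Hausdorff_space X"
  shows "tychonoff_space (compact_sum X)"
proof -
  have "Hausdorff_space (compact_sum X)"
    unfolding compact_sum_def
    by (intro Hausdorff_space_sum_topology Hausdorff_space_subtopology assms)
  then show ?thesis
    by (simp add: tychonoff_space_def locally_compact_regular_imp_completely_regular_space
        locally_compact_space_compact_sum)
qed

lemma continuous_map_compact_sum_snd: "continuous_map (compact_sum X) X snd"
  unfolding continuous_map_alt
proof (intro conjI allI impI)
  show "snd \<in> topspace (compact_sum X) \<rightarrow> topspace X"
    by (auto simp: topspace_compact_sum dest: subsetD[OF compactin_subset_topspace])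
  fix W assume W: "openin X W"
  \<comment> \<open>Openness in the sum is tested summand by summand, and each slice of the preimage
    is the trace of \<open>W\<close> on \<open>K\<close>.\<close>
  have "{x. (K, x) \<in> snd -` W \<inter> topspace (compact_sum X)} = W \<inter> K" if "compactin X K" for K
    using that by (auto simp: topspace_compact_sum)
  then show "openin (compact_sum X) (snd -` W \<inter> topspace (compact_sum X))"
    using W by (force simp: compact_sum_def openin_sum_topology openin_subtopology)
qed

lemma snd_image_topspace_compact_sum: "snd ` topspace (compact_sum X) = topspace X"
proof
  show "snd ` topspace (compact_sum X) \<subseteq> topspace X"
    by (auto simp: topspace_compact_sum dest: subsetD[OF compactin_subset_topspace])
  show "topspace X \<subseteq> snd ` topspace (compact_sum X)"
  proof
    fix x assume "x \<in> topspace X"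
    \<comment> \<open>Singletons are compact, so every point occurs in some summand.\<close>
    then have "({x}, x) \<in> topspace (compact_sum X)"
      by (simp add: topspace_compact_sum)
    then show "x \<in> snd ` topspace (compact_sum X)"
      by force
  qed
qed

lemma open_compact_attainable_imp_kappa_pseudo_open_map:
  assumes "open_compact_attainable X"
  shows "kappa_pseudo_open_map (compact_sum X) X snd"
  unfolding kappa_pseudo_open_map_def
proof (intro conjI allI impI; (elim conjE)?)
  fix y U
  assume y: "y \<in> topspace X" and U: "openin (compact_sum X) U"
    and fibre: "{p \<in> topspace (compact_sum X). snd p = y} \<subseteq> U"
  define W where "W = topspace X - X closure_of (snd ` U)"
  show "y \<in> X interior_of (X closure_of (snd ` U))"
  proof (rule ccontr)
    assume "y \<notin> X interior_of (X closure_of (snd ` U))"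
    \<comment> \<open>The interior of a set is the complement of the closure of its
      complement.\<close>
    then have "y \<in> X closure_of W"
      using y by (simp add: W_def interior_of_closure_of)
    moreover have "openin X W"
      by (simp add: W_def openin_diff)
    ultimately obtain K where K: "compactin X K" "y \<in> K" "y \<in> X closure_of (K \<inter> W)"
      using assms unfolding open_compact_attainable_def by blast
    obtain V where V: "openin X V" "{x. (K, x) \<in> U} = V \<inter> K"
      using openin_compact_sum_layer[OF U K(1)] .
    have "(K, y) \<in> U"
      using fibre K by (auto simp: topspace_compact_sum)
    then have "y \<in> V"
      using V by blast
    then obtain x where x: "x \<in> K" "x \<in> W" "x \<in> V"
      using K(3) V(1) by (auto simp: in_closure_of)
    then have "(K, x) \<in> U"
      using V(2) by blast
    then have "x \<in> snd ` U"
      by force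
    then have "x \<in> X closure_of (snd ` U)"
      using x(2) by (auto simp: W_def in_closure_of)
    then show False
      using x(2) by (simp add: W_def)
  qed
qed (rule continuous_map_compact_sum_snd snd_image_topspace_compact_sum)+

lemma kappa_pseudo_open_map_imp_open_compact_attainable:
  assumes lc: "locally_compact_space Z" and f: "kappa_pseudo_open_map Z X f"
  shows "open_compact_attainable X"
  unfolding open_compact_attainable_def
proof (intro allI impI; elim conjE; rule ccontr)
  fix W z
  assume W: "openin X W" and z: "z \<in> X closure_of W"
    and none: "\<not> (\<exists>K. compactin X K \<and> z \<in> K \<inter> X closure_of (K \<inter> W))"
  have cont: "continuous_map Z X f"
    using f by (simp add: kappa_pseudo_open_map_def)
  have zX: "z \<in> topspace X"
    using z by (simp add: in_closure_of)
  define U where "U = \<Union>{N. openin Z N \<and> f ` N \<inter> W = {}}"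
  have "openin Z U"
    by (auto simp: U_def)
  moreover have "{x \<in> topspace Z. f x = z} \<subseteq> U"
  proof clarify
    fix x assume x: "x \<in> topspace Z" and fx: "z = f x"
    obtain N C where N: "openin Z N" "compactin Z C" "x \<in> N" "N \<subseteq> C"
      using lc x unfolding locally_compact_space_def by blast
    have "compactin X (f ` C)"
      using image_compactin[OF N(2) cont] .
    moreover have "z \<in> f ` C"
      using N fx by blast
    ultimately have "z \<notin> X closure_of (f ` C \<inter> W)"
      using none by blast
    then obtain V where V: "openin X V" "z \<in> V" "V \<inter> (f ` C \<inter> W) = {}"
      using zX by (auto simp: in_closure_of)
    have "openin Z (N \<inter> {x \<in> topspace Z. f x \<in> V})"
      using N(1) openin_continuous_map_preimage[OF cont V(1)] by blast
    moreover have "f ` (N \<inter> {x \<in> topspace Z. f x \<in> V}) \<inter> W = {}"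
      using N(4) V(3) by blast
    ultimately show "x \<in> U"
      unfolding U_def using N(3) V(2) x fx by blast
  qed
  ultimately have "z \<in> X interior_of (X closure_of (f ` U))"
    using f zX unfolding kappa_pseudo_open_map_def by blast
  then obtain w where "w \<in> W" "w \<in> X closure_of (f ` U)"
    using z interior_of_subset[of X "X closure_of (f ` U)"]
    by (meson in_closure_of openin_interior_of subsetD)
  then obtain u where "u \<in> f ` U" "u \<in> W"
    using W unfolding in_closure_of by blast
  then show False
    by (auto simp: U_def)
qed

lemma kappa_pseudo_open_image_imp_open_compact_attainable:
  assumes "kappa_pseudo_open_image_of_locally_compact TYPE('b) X"
  shows "open_compact_attainable X"
proof -
  obtain Z :: "'b topology" and f where "locally_compact_space Z" "kappa_pseudo_open_map Z X f"
    using assms unfolding kappa_pseudo_open_image_of_locally_compact_def by blast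
  then show ?thesis
    by (rule kappa_pseudo_open_map_imp_open_compact_attainable)
qed

text \<open>Condition (iii) ranges over spaces of any type. For existence the carrier type of the
  sum suffices, since \<open>compact_sum X\<close> with \<open>snd\<close> is a witness; the last
  conjunct, with \<open>'b\<close> free, covers domains over every other type.\<close>

theorem theorem5p1:
  fixes X :: "'a topology"
  assumes "tychonoff_space X"
  shows "(open_compact_attainable X \<longleftrightarrow> kappa_pseudo_open_map (compact_sum X) X snd) \<and>
    (open_compact_attainable X \<longleftrightarrow>
       kappa_pseudo_open_image_of_locally_compact TYPE('a set \<times> 'a) X) \<and>
    (kappa_pseudo_open_image_of_locally_compact TYPE('b) X \<longrightarrow> open_compact_attainable X)"
proof -
  have "tychonoff_space (compact_sum X)"
    using assms by (intro tychonoff_space_compact_sum) (simp add: tychonoff_space_def)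
  then have image: "kappa_pseudo_open_image_of_locally_compact TYPE('a set \<times> 'a) X"
    if "kappa_pseudo_open_map (compact_sum X) X snd"
    unfolding kappa_pseudo_open_image_of_locally_compact_def
    using that locally_compact_space_compact_sum by blast
  show ?thesis
    by (meson open_compact_attainable_imp_kappa_pseudo_open_map image
        kappa_pseudo_open_image_imp_open_compact_attainable)
qed

end
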